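(* Any Oeljeklaus-Toma manifold $X(K,U)$ carries a locally conformally balanced metric.
   Context: **Oeljeklaus-Toma (OT) manifolds.** Let $K$ be an algebraic number field of degree $[K:\mathbb{Q}]=s+2t$ with $s\ge 1$ real embeddings $\sigma_1,\ldots,\sigma_s:K\hookrightarrow\mathbb{R}$ and $2t$ ($t\ge 1$) non-real complex embeddings $\sigma_{s+1},\ldots,\sigma_{s+2t}:K\hookrightarrow\mathbb{C}$, ordered so that $\sigma_{s+t+i}=\overline{\sigma_{s+i}}$ for $1\le i\le t$. Let $\mathcal{O}_K$ be the ring of integers of $K$ and $\mathcal{O}_K^{*,+}$ the group of totally positive units, i.e. units $u$ with $\sigma_i(u)>0$ for all $1\le i\le s$. Let $\mathbb{H}=\{z\in\mathbb{C}:\mathrm{Im}\,z>0\}$. The group $\mathcal{O}_K$ acts on $\mathbb{H}^s\times\mathbb{C}^t$ by translations $$T_a(w_1,\ldots,w_s,z_1,\ldots,z_t)=(w_1+\sigma_1(a),\ldots,w_s+\sigma_s(a),z_1+\sigma_{s+1}(a),\ldots,z_t+\sigma_{s+t}(a)),$$ and $\mathcal{O}_K^{*,+}$ acts by $$R_u(w_1,\ldots,w_s,z_1,\ldots,z_t)=(\sigma_1(u)w_1,\ldots,\sigma_s(u)w_s,\sigma_{s+1}(u)z_1,\ldots,\sigma_{s+t}(u)z_t).$$ Define $l:\mathcal{O}_K^{*,+}\to\mathbb{R}^{s+t}$ by $l(u)=(\log\sigma_1(u),\ldots,\log\sigma_s(u),2\log|\sigma_{s+1}(u)|,\ldots,2\log|\sigma_{s+t}(u)|)$.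 A subgroup $U\subseteq\mathcal{O}_K^{*,+}$ is called admissible if it is free of rank $s$ and the projection of $l(U)$ to the first $s$ coordinates is a lattice of rank $s$ in $\mathbb{R}^s$. For admissible $U$ the action of $U\ltimes\mathcal{O}_K$ on $\mathbb{H}^s\times\mathbb{C}^t$ is fixed-point-free, properly discontinuous and cocompact, and the OT manifold of type $(s,t)$ associated to $K$ and the admissible subgroup $U$ is the compact complex manifold $X(K,U)=(\mathbb{H}^s\times\mathbb{C}^t)/(U\ltimes\mathcal{O}_K)$, of complex dimension $n=s+t$. **Metrics.** A Hermitian metric on a complex manifold of complex dimension $n$ is identified with its (smooth, real, positive) fundamental $(1,1)$-form $\Omega$. It is called locally conformally balanced if $d\Omega^{n-1}=\theta\wedge\Omega^{n-1}$ for some closed real one-form $\theta$. *)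

theory Defs
  imports "HOL-Analysis.Analysis" "HOL-Combinatorics.Permutations"
    "HOL-Computational_Algebra.Polynomial"
begin

section \<open>Differential forms on open subsets of a Euclidean space\<close>

primrec C_k_on :: "nat \<Rightarrow> 'e::euclidean_space set \<Rightarrow> ('e \<Rightarrow> real) \<Rightarrow> bool" where
  "C_k_on 0 S f = continuous_on S f"
| "C_k_on (Suc k) S f =
     ((\<forall>x\<in>S. f differentiable (at x)) \<and>
      (\<forall>v. C_k_on k S (\<lambda>x. frechet_derivative f (at x) v)))"

definition smooth_on :: "'e::euclidean_space set \<Rightarrow> ('e \<Rightarrow> real) \<Rightarrow> bool" where
  "smooth_on S f \<longleftrightarrow> (\<forall>k. C_k_on k S f)"

text \<open>
  A real \<open>k\<close>-form \<open>\<omega>\<close> is evaluated as \<open>\<omega> x v\<close>, where the sequence \<open>v\<close> carries the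
  tangent vectors \<open>v 0, \<dots>, v (k - 1)\<close>; its later entries are irrelevant.
\<close>

type_synonym 'e dform = "'e \<Rightarrow> (nat \<Rightarrow> 'e) \<Rightarrow> real"

definition alternating :: "nat \<Rightarrow> ((nat \<Rightarrow> 'e::euclidean_space) \<Rightarrow> real) \<Rightarrow> bool" where
  "alternating k f \<longleftrightarrow>
     (\<forall>v w. (\<forall>i<k. v i = w i) \<longrightarrow> f v = f w) \<and>
     (\<forall>v. \<forall>i<k. linear (\<lambda>x. f (v(i := x)))) \<and>
     (\<forall>v. \<forall>i<k. \<forall>j<k. i \<noteq> j \<longrightarrow> v i = v j \<longrightarrow> f v = 0)"

definition smooth_form_on :: "nat \<Rightarrow> 'e::euclidean_space set \<Rightarrow> 'e dform \<Rightarrow> bool" where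
  "smooth_form_on k S \<omega> \<longleftrightarrow>
     (\<forall>x\<in>S. alternating k (\<omega> x)) \<and> (\<forall>v. smooth_on S (\<lambda>x. \<omega> x v))"

text \<open>Normalisation: \<open>(\<alpha> \<and> \<beta>)(v, w) = \<alpha> v * \<beta> w - \<alpha> w * \<beta> v\<close> for one-forms.\<close>

definition wedge :: "nat \<Rightarrow> nat \<Rightarrow> 'e dform \<Rightarrow> 'e dform \<Rightarrow> 'e dform" where
  "wedge p q \<alpha> \<beta> x v =
     (\<Sum>\<pi> | \<pi> permutes {..<p + q}.
        of_int (sign \<pi>) * \<alpha> x (\<lambda>i. v (\<pi> i)) * \<beta> x (\<lambda>i. v (\<pi> (p + i)))) / (fact p * fact q)"

primrec wedge_power :: "'e dform \<Rightarrow> nat \<Rightarrow> 'e dform" \<comment> \<open>powers of a two-form\<close> where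
  "wedge_power \<omega> 0 = (\<lambda>x v. 1)"
| "wedge_power \<omega> (Suc m) = wedge 2 (2 * m) \<omega> (wedge_power \<omega> m)"

text \<open>
  \<open>d\<omega>(v\<^sub>0,\<dots>,v\<^sub>k) = \<Sum>\<^sub>i (-1)\<^sup>i D\<^bsub>v\<^sub>i\<^esub> (\<omega>(v\<^sub>0,\<dots>,v\<^sub>i omitted,\<dots>,v\<^sub>k))\<close> for constant fields \<open>v\<^sub>i\<close>.
\<close>

definition ext_deriv :: "nat \<Rightarrow> 'e::euclidean_space dform \<Rightarrow> 'e dform" where
  "ext_deriv k \<omega> x v =
     (\<Sum>i\<le>k. (-1) ^ i *
        frechet_derivative (\<lambda>y. \<omega> y (\<lambda>j. v (if j < i then j else Suc j))) (at x) (v i))"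

definition pullback :: "('e::euclidean_space \<Rightarrow> 'e) \<Rightarrow> 'e dform \<Rightarrow> 'e dform" where
  "pullback f \<omega> x v = \<omega> (f x) (\<lambda>i. frechet_derivative f (at x) (v i))"


section \<open>Forms and metrics on a complex manifold given by an atlas\<close>

text \<open>
  A chart is a pair of its domain and its coordinate map into \<open>\<complex>\<^sup>n\<close>, \<open>n = CARD('n)\<close>; values
  of the coordinate map off the domain are irrelevant.  A differential form is a family of
  forms on the chart images, compatible under the transition maps; \<open>d\<close> and \<open>\<and>\<close> are
  computed in each chart.
\<close>

type_synonym ('m, 'n) chart = "'m set \<times> ('m \<Rightarrow> complex ^ 'n)"
type_synonym ('m, 'n) mform = "('m, 'n) chart \<Rightarrow> (complex ^ 'n) dform"

definition chart_image :: "('m, 'n) chart \<Rightarrow> (complex ^ 'n) set" where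
  "chart_image c = snd c ` fst c"

definition transition ::
  "('m, 'n) chart \<Rightarrow> ('m, 'n) chart \<Rightarrow> complex ^ 'n \<Rightarrow> complex ^ 'n" where
  "transition c c' x = snd c' (inv_into (fst c) (snd c) x)"

definition mform :: "('m, 'n::finite) chart set \<Rightarrow> nat \<Rightarrow> ('m, 'n) mform \<Rightarrow> bool" where
  "mform A k \<omega> \<longleftrightarrow>
     (\<forall>c\<in>A. smooth_form_on k (chart_image c) (\<omega> c)) \<and>
     (\<forall>c\<in>A. \<forall>c'\<in>A. \<forall>x \<in> snd c ` (fst c \<inter> fst c'). \<forall>v.
        \<omega> c x v = pullback (transition c c') (\<omega> c') x v)"

definition mform_eq ::
  "('m, 'n::finite) chart set \<Rightarrow> ('m, 'n) mform \<Rightarrow> ('m, 'n) mform \<Rightarrow> bool" where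
  "mform_eq A \<omega> \<eta> \<longleftrightarrow> (\<forall>c\<in>A. \<forall>x\<in>chart_image c. \<forall>v. \<omega> c x v = \<eta> c x v)"

definition closed_mform :: "('m, 'n::finite) chart set \<Rightarrow> nat \<Rightarrow> ('m, 'n) mform \<Rightarrow> bool" where
  "closed_mform A k \<omega> \<longleftrightarrow>
     mform A k \<omega> \<and> mform_eq A (\<lambda>c. ext_deriv k (\<omega> c)) (\<lambda>c x v. 0)"

text \<open>
  The fundamental form of a Hermitian metric: a real two-form of type \<open>(1,1)\<close>, i.e.
  \<open>\<Omega>(Jv, Jw) = \<Omega>(v, w)\<close>, that is positive, i.e. \<open>\<Omega>(v, Jv) > 0\<close> for \<open>v \<noteq> 0\<close>,
  where \<open>J\<close> is multiplication by \<open>\<i>\<close>.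
\<close>

definition hermitian_metric :: "('m, 'n::finite) chart set \<Rightarrow> ('m, 'n) mform \<Rightarrow> bool" where
  "hermitian_metric A \<Omega> \<longleftrightarrow>
     mform A 2 \<Omega> \<and>
     (\<forall>c\<in>A. \<forall>x\<in>chart_image c.
        (\<forall>v. \<Omega> c x (\<lambda>i. \<i> *s v i) = \<Omega> c x v) \<and>
        (\<forall>v. v \<noteq> 0 \<longrightarrow> \<Omega> c x (\<lambda>i. if i = 0 then v else \<i> *s v) > 0))"

definition locally_conformally_balanced ::
  "('m, 'n::finite) chart set \<Rightarrow> ('m, 'n) mform \<Rightarrow> bool" where
  "locally_conformally_balanced A \<Omega> \<longleftrightarrow>
     hermitian_metric A \<Omega> \<and>
     (\<exists>\<theta>. closed_mform A 1 \<theta> \<and>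
        (let m = CARD('n) - 1 in
          mform_eq A (\<lambda>c. ext_deriv (2 * m) (wedge_power (\<Omega> c) m))
            (\<lambda>c. wedge 1 (2 * m) (\<theta> c) (wedge_power (\<Omega> c) m))))"

text \<open>
  The complex structure on the quotient \<open>p ` D\<close> of an open set \<open>D\<close> by a free, properly
  discontinuous group of biholomorphisms with quotient map \<open>p\<close>: the charts are the local
  inverses of \<open>p\<close>.
\<close>

definition quotient_atlas ::
  "(complex ^ 'n) set \<Rightarrow> (complex ^ 'n \<Rightarrow> 'm) \<Rightarrow> ('m, 'n::finite) chart set" where
  "quotient_atlas D p = {(p ` W, inv_into W p) | W. open W \<and> W \<subseteq> D \<and> inj_on p W}"


section \<open>Number fields and Oeljeklaus-Toma manifolds\<close>

definition field_embedding :: "('k::field \<Rightarrow> 'b::field) \<Rightarrow> bool" where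
  "field_embedding f \<longleftrightarrow>
     f 1 = 1 \<and> (\<forall>x y. f (x + y) = f x + f y) \<and> (\<forall>x y. f (x * y) = f x * f y)"

text \<open>
  The type \<open>'k\<close> is a number field of degree \<open>s + 2t\<close> with \<open>s = CARD('s)\<close> and \<open>t = CARD('t)\<close>.
  The family \<open>\<sigma>\<close> enumerates its real embeddings, and \<open>\<tau>\<close> together with its conjugates
  enumerates the non-real complex ones.  The degree is positive, so the convention that
  infinite dimensions are \<open>0\<close> does no harm.
\<close>

definition number_field_embeddings ::
  "('s::finite \<Rightarrow> 'k::field_char_0 \<Rightarrow> real) \<Rightarrow> ('t::finite \<Rightarrow> 'k \<Rightarrow> complex) \<Rightarrow> bool" where
  "number_field_embeddings \<sigma> \<tau> \<longleftrightarrow>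
     vector_space.dim (\<lambda>q (x::'k). of_rat q * x) UNIV = CARD('s) + 2 * CARD('t) \<and>
     bij_betw \<sigma> UNIV {f. field_embedding f} \<and>
     bij_betw (case_sum \<tau> (\<lambda>j a. cnj (\<tau> j a))) UNIV
       {f. field_embedding f \<and> \<not> range f \<subseteq> \<real>}"

definition ring_of_integers :: "'k::field_char_0 set" where
  "ring_of_integers = {a. algebraic_int a}"

definition totally_positive_units ::
  "('s \<Rightarrow> 'k::field_char_0 \<Rightarrow> real) \<Rightarrow> 'k set" where
  "totally_positive_units \<sigma> =
     {u. u \<noteq> 0 \<and> u \<in> ring_of_integers \<and> inverse u \<in> ring_of_integers \<and> (\<forall>i. \<sigma> i u > 0)}"

definition log_embedding ::
  "('s::finite \<Rightarrow> 'k \<Rightarrow> real) \<Rightarrow> ('t::finite \<Rightarrow> 'k \<Rightarrow> complex) \<Rightarrow> 'k \<Rightarrow> real ^ ('s + 't)" where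
  "log_embedding \<sigma> \<tau> u =
     (\<chi> i. case i of Inl i \<Rightarrow> ln (\<sigma> i u) | Inr j \<Rightarrow> 2 * ln (cmod (\<tau> j u)))"

definition real_part_projection :: "real ^ ('s::finite + 't::finite) \<Rightarrow> real ^ 's" where
  "real_part_projection x = (\<chi> i. x $ Inl i)"

definition mult_subgroup :: "'k::field set \<Rightarrow> bool" where
  "mult_subgroup U \<longleftrightarrow>
     0 \<notin> U \<and> 1 \<in> U \<and> (\<forall>u\<in>U. \<forall>v\<in>U. u * v \<in> U) \<and> (\<forall>u\<in>U. inverse u \<in> U)"

definition free_of_rank :: "nat \<Rightarrow> 'k::field set \<Rightarrow> bool" where
  "free_of_rank r U \<longleftrightarrow>
     (\<exists>B. finite B \<and> card B = r \<and>
        bij_betw (\<lambda>k. \<Prod>b\<in>B. b powi k b) (B \<rightarrow>\<^sub>E (UNIV :: int set)) U)"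

definition lattice_of_rank :: "nat \<Rightarrow> 'e::euclidean_space set \<Rightarrow> bool" where
  "lattice_of_rank r L \<longleftrightarrow>
     (\<exists>B. finite B \<and> card B = r \<and> independent B \<and>
        L = range (\<lambda>k :: 'e \<Rightarrow> int. \<Sum>b\<in>B. of_int (k b) *\<^sub>R b))"

definition admissible ::
  "('s::finite \<Rightarrow> 'k::field_char_0 \<Rightarrow> real) \<Rightarrow> ('t::finite \<Rightarrow> 'k \<Rightarrow> complex) \<Rightarrow> 'k set \<Rightarrow> bool" where
  "admissible \<sigma> \<tau> U \<longleftrightarrow>
     mult_subgroup U \<and> U \<subseteq> totally_positive_units \<sigma> \<and>
     free_of_rank CARD('s) U \<and>
     lattice_of_rank CARD('s) (real_part_projection ` log_embedding \<sigma> \<tau> ` U)"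

text \<open>\<open>\<H>\<^sup>s \<times> \<complex>\<^sup>t\<close> as an open subset of \<open>\<complex>\<^bsup>s+t\<^esup>\<close>, whose coordinates are indexed by \<open>'s + 't\<close>.\<close>

definition ot_domain :: "(complex ^ ('s::finite + 't::finite)) set" where
  "ot_domain = {z. \<forall>i. Im (z $ Inl i) > 0}"

definition ot_translation ::
  "('s::finite \<Rightarrow> 'k \<Rightarrow> real) \<Rightarrow> ('t::finite \<Rightarrow> 'k \<Rightarrow> complex) \<Rightarrow> 'k \<Rightarrow>
   complex ^ ('s + 't) \<Rightarrow> complex ^ ('s + 't)" where
  "ot_translation \<sigma> \<tau> a z =
     (\<chi> i. z $ i + (case i of Inl i \<Rightarrow> of_real (\<sigma> i a) | Inr j \<Rightarrow> \<tau> j a))"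

definition ot_rotation ::
  "('s::finite \<Rightarrow> 'k \<Rightarrow> real) \<Rightarrow> ('t::finite \<Rightarrow> 'k \<Rightarrow> complex) \<Rightarrow> 'k \<Rightarrow>
   complex ^ ('s + 't) \<Rightarrow> complex ^ ('s + 't)" where
  "ot_rotation \<sigma> \<tau> u z =
     (\<chi> i. (case i of Inl i \<Rightarrow> of_real (\<sigma> i u) | Inr j \<Rightarrow> \<tau> j u) * z $ i)"

text \<open>The element \<open>(u, a)\<close> of \<open>U \<ltimes> \<O>\<^sub>K\<close> acts as \<open>T\<^sub>a \<circ> R\<^sub>u\<close>.\<close>

definition ot_orbit ::
  "('s::finite \<Rightarrow> 'k::field_char_0 \<Rightarrow> real) \<Rightarrow> ('t::finite \<Rightarrow> 'k \<Rightarrow> complex) \<Rightarrow> 'k set \<Rightarrow>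
   complex ^ ('s + 't) \<Rightarrow> (complex ^ ('s + 't)) set" where
  "ot_orbit \<sigma> \<tau> U z =
     {ot_translation \<sigma> \<tau> a (ot_rotation \<sigma> \<tau> u z) | u a. u \<in> U \<and> a \<in> ring_of_integers}"

text \<open>
  \<open>X(K, U)\<close>, given by its atlas; its points are the orbits of the points of \<open>ot_domain\<close>.
\<close>

definition ot_manifold ::
  "('s::finite \<Rightarrow> 'k::field_char_0 \<Rightarrow> real) \<Rightarrow> ('t::finite \<Rightarrow> 'k \<Rightarrow> complex) \<Rightarrow> 'k set \<Rightarrow>
   ((complex ^ ('s + 't)) set, 's + 't) chart set" where
  "ot_manifold \<sigma> \<tau> U = quotient_atlas ot_domain (ot_orbit \<sigma> \<tau> U)"

end

theory Submission
  imports Defs "Jordan_Normal_Form.Determinant"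
begin

text \<open>
  Write \<open>w\<^sub>i = x\<^sub>i + \<i> y\<^sub>i\<close> for the first \<open>s\<close> coordinates of \<open>\<H>\<^sup>s \<times> \<complex>\<^sup>t\<close>.  An admissible group \<open>U\<close> has
  the same rank as its image in \<open>\<real>\<^sup>s\<close> under the logarithms of the real places, and this image spans
  \<open>\<real>\<^sup>s\<close>.  Hence every homomorphism \<open>U \<rightarrow> \<real>\<close> is the restriction of a linear functional on \<open>\<real>\<^sup>s\<close>; in
  particular \<open>\<bar>\<tau>\<^sub>j(u)\<bar>\<^sup>2 = \<Prod>\<^sub>i \<sigma>\<^sub>i(u)\<^bsup>a(j,i)\<^esup>\<close> with real exponents that do not depend on \<open>u \<in> U\<close>
  (\<open>admissible_log_relation\<close>).  The form
  \<open>\<Omega> = \<Sum>\<^sub>i y\<^sub>i\<^bsup>-2\<^esup> dx\<^sub>i \<and> dy\<^sub>i + \<Sum>\<^sub>j (\<Prod>\<^sub>i y\<^sub>i\<^bsup>-a(j,i)\<^esup>) dx\<^bsub>s+j\<^esub> \<and> dy\<^bsub>s+j\<^esub>\<close>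
  is therefore invariant under \<open>U \<ltimes> \<O>\<^sub>K\<close> and descends to a Hermitian metric on the quotient.

  It is diagonal, with coefficients \<open>h\<^sub>l\<close> that are monomials in the \<open>y\<^sub>i\<close> with real exponents.
  Consequently \<open>\<Omega>\<^bsup>n-1\<^esup>\<close> is a combination of the constant forms \<open>\<And>\<^bsub>l\<noteq>k\<^esub> dx\<^sub>l \<and> dy\<^sub>l\<close>, with coefficient a
  multiple of \<open>\<Prod>\<^bsub>l\<noteq>k\<^esub> h\<^sub>l\<close>.  The differential of this coefficient is the coefficient times a sum of
  multiples of \<open>dy\<^sub>i / y\<^sub>i\<close>, and \<open>dy\<^sub>i \<and> \<And>\<^bsub>l\<noteq>k\<^esub> dx\<^sub>l \<and> dy\<^sub>l\<close> vanishes unless \<open>k = i\<close>.  Only one multiple of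
  each \<open>dy\<^sub>i / y\<^sub>i\<close> thus matters, the exponent \<open>c\<^sub>i\<close> of \<open>y\<^sub>i\<close> in \<open>\<Prod>\<^bsub>l\<noteq>i\<^esub> h\<^sub>l\<close>, and
  \<open>d\<Omega>\<^bsup>n-1\<^esup> = \<theta> \<and> \<Omega>\<^bsup>n-1\<^esup>\<close> for \<open>\<theta> = \<Sum>\<^sub>i c\<^sub>i dy\<^sub>i / y\<^sub>i\<close>
  (\<open>ext_deriv_wedge_power_diagonal_form\<close>).  The form \<open>\<theta>\<close> is closed, and it is invariant because the
  group only rescales each \<open>y\<^sub>i\<close> by a constant.

  Constant-coefficient forms are represented by determinants of pairings of functionals with
  vectors.  A wedge product then concatenates lists of functionals (\<open>wedge_exterior\<close>), and the
  Laplace expansion identifies the alternating sum in the exterior derivative with prepending a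
  functional (\<open>exterior_Cons\<close>).  On the quotient, \<open>\<Omega>\<close> and \<open>\<theta>\<close> are given by the same formula in every
  chart; that this is consistent rests on the transition maps being locally elements of the group
  (\<open>ot_transition\<close>).
\<close>

(* The dollar sign is kept for the coordinates of complex ^ 'n. *)
no_notation Matrix.vec_index (infixl "$" 100)


section \<open>Products of linear functionals as determinants\<close>

text \<open>
  The wedge product of the functionals \<open>fs\<close>, evaluated on \<open>v 0, v 1, \<dots>\<close>.
\<close>

definition exterior :: "('e \<Rightarrow> real) list \<Rightarrow> (nat \<Rightarrow> 'e) \<Rightarrow> real" where
  "exterior fs v = (\<Sum>\<pi> | \<pi> permutes {..<length fs}.
     of_int (sign \<pi>) * (\<Prod>i<length fs. (fs ! i) (v (\<pi> i))))"

lemma exterior_Nil [simp]: "exterior [] v = 1"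
  by (simp add: exterior_def)

abbreviation pairing_mat :: "('e \<Rightarrow> real) list \<Rightarrow> (nat \<Rightarrow> 'e) \<Rightarrow> real mat" where
  "pairing_mat fs v \<equiv> mat (length fs) (length fs) (\<lambda>(i, j). (fs ! i) (v j))"

lemma exterior_eq_det: "exterior fs v = Determinant.det (pairing_mat fs v)"
proof -
  have "Determinant.det (pairing_mat fs v) = (\<Sum>\<pi> | \<pi> permutes {0..<length fs}.
     of_int (sign \<pi>) * (\<Prod>i = 0..<length fs. pairing_mat fs v $$ (i, \<pi> i)))"
    by (rule det_def') simp
  also have "\<dots> = exterior fs v"
    unfolding exterior_def atLeast0LessThan[symmetric]
    by (intro sum.cong refl arg_cong2[where f = "(*)"] prod.cong)
       (auto simp: permutes_in_image)
  finally show ?thesis by simp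
qed

lemma exterior_not_distinct:
  assumes "\<not> distinct fs"
  shows "exterior fs v = 0"
proof -
  obtain i j where ij: "i < length fs" "j < length fs" "i \<noteq> j" "fs ! i = fs ! j"
    using assms by (auto simp: distinct_conv_nth)
  have "Determinant.det (pairing_mat fs v) = 0"
    by (rule Determinant.det_identical_rows[of _ "length fs" i j])
       (use ij in \<open>auto intro!: eq_vecI\<close>)
  then show ?thesis by (simp add: exterior_eq_det)
qed

text \<open>
  Laplace expansion along the first row.  The sum has the shape of the one that defines
  \<^const>\<open>ext_deriv\<close>, which is how exterior derivatives become wedge products with a differential.
\<close>

lemma exterior_Cons:
  "exterior (f # fs) v =
     (\<Sum>i\<le>length fs. (-1) ^ i * f (v i) * exterior fs (\<lambda>j. v (if j < i then j else Suc j)))"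
proof -
  let ?A = "pairing_mat (f # fs) v"
  have "Determinant.det ?A = (\<Sum>j<Suc (length fs). ?A $$ (0, j) * cofactor ?A 0 j)"
    by (rule laplace_expansion_row) auto
  also have "\<dots> = (\<Sum>i\<le>length fs.
      (-1) ^ i * f (v i) * exterior fs (\<lambda>j. v (if j < i then j else Suc j)))"
    unfolding lessThan_Suc_atMost
  proof (intro sum.cong refl)
    fix i assume "i \<in> {..length fs}"
    then have "mat_delete ?A 0 i = pairing_mat fs (\<lambda>j. v (if j < i then j else Suc j))"
      by (intro eq_matI) (auto simp: mat_delete_def)
    with \<open>i \<in> _\<close> show "?A $$ (0, i) * cofactor ?A 0 i =
        (-1) ^ i * f (v i) * exterior fs (\<lambda>j. v (if j < i then j else Suc j))"
      by (simp add: cofactor_def exterior_eq_det)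
  qed
  finally show ?thesis by (simp add: exterior_eq_det)
qed

lemma exterior_Cons_sum:
  assumes "\<And>i. i \<le> length fs \<Longrightarrow> f (v i) = (\<Sum>a\<in>I. c a * g a (v i))"
  shows "exterior (f # fs) v = (\<Sum>a\<in>I. c a * exterior (g a # fs) v)"
proof -
  let ?e = "\<lambda>i. exterior fs (\<lambda>j. v (if j < i then j else Suc j))"
  have "exterior (f # fs) v =
      (\<Sum>i\<le>length fs. \<Sum>a\<in>I. c a * ((-1) ^ i * g a (v i) * ?e i))"
    unfolding exterior_Cons using assms
    by (intro sum.cong refl) (simp add: sum_distrib_left sum_distrib_right mult_ac)
  also have "\<dots> = (\<Sum>a\<in>I. c a * exterior (g a # fs) v)"
    unfolding exterior_Cons sum_distrib_left by (rule sum.swap)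
  finally show ?thesis .
qed

text \<open>
  The block permutation acting by \<open>\<rho>\<close> on the first \<open>p\<close> positions and by \<open>\<tau>\<close> on the next \<open>q\<close>.
\<close>

lemma permutes_append:
  fixes p q :: nat
  assumes \<rho>: "\<rho> permutes {..<p}" and \<tau>: "\<tau> permutes {..<q}"
  obtains \<kappa> where "\<kappa> permutes {..<p + q}" "sign \<kappa> = sign \<rho> * sign \<tau>"
    "\<And>i. i < p \<Longrightarrow> \<kappa> i = \<rho> i" "\<And>i. i < q \<Longrightarrow> \<kappa> (p + i) = p + \<tau> i"
proof
  let ?t = "map_permutation {..<q} ((+) p) \<tau>"
  have t: "?t permutes (+) p ` {..<q}"
    using \<tau> by (intro map_permutation_permutes) (simp_all add: bij_betw_def inj_on_def)
  have img: "(+) p ` {..<q} = {p..<p + q}"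
    using image_add_atLeastLessThan[of p 0 q] by (simp add: atLeast0LessThan add.commute)
  have t': "?t permutes {..<p + q}"
    using t unfolding img by (rule permutes_subset) auto
  have r': "\<rho> permutes {..<p + q}"
    using \<rho> by (rule permutes_subset) auto
  show "(\<rho> \<circ> ?t) permutes {..<p + q}"
    using t' r' by (rule permutes_compose)
  have "sign ?t = sign \<tau>"
    using \<tau> by (intro sign_map_permutation) auto
  then show "sign (\<rho> \<circ> ?t) = sign \<rho> * sign \<tau>"
    using t' r' by (subst sign_compose) (auto simp: permutation_permutes)
  show "(\<rho> \<circ> ?t) i = \<rho> i" if "i < p" for i
    using permutes_not_in[OF t, of i] that by (auto simp: img)
  show "(\<rho> \<circ> ?t) (p + i) = p + \<tau> i" if "i < q" for i
  proof -
    have "?t (p + i) = p + \<tau> i"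
      using map_permutation_apply[of "(+) p" "{..<q}" i \<tau>] that by auto
    then show ?thesis using permutes_not_in[OF \<rho>, of "p + \<tau> i"] by simp
  qed
qed

text \<open>
  Expanding both determinants turns the wedge product into a triple sum over \<open>\<pi>\<close>, \<open>\<rho>\<close> and \<open>\<tau>\<close>.  For
  fixed \<open>\<rho>\<close> and \<open>\<tau>\<close>, composing \<open>\<pi>\<close> with the block permutation of \<open>\<rho>\<close> and \<open>\<tau>\<close> gives the expansion of the
  big determinant, so the sum counts that determinant \<open>p! q!\<close> times, and this is the factor by which
  \<^const>\<open>wedge\<close> divides.
\<close>

lemma wedge_exterior:
  assumes "length fs = p" "length gs = q"
  shows "wedge p q (\<lambda>x. exterior fs) (\<lambda>x. exterior gs) x v = exterior (fs @ gs) v"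
proof -
  let ?P = "\<lambda>n. {\<pi>. \<pi> permutes {..<n::nat}}"
  let ?f = "\<lambda>\<rho> \<pi>. \<Prod>i<p. (fs ! i) (v (\<pi> (\<rho> i)))"
  let ?g = "\<lambda>\<tau> \<pi>. \<Prod>i<q. (gs ! i) (v (\<pi> (p + \<tau> i)))"
  have inner: "(\<Sum>\<pi>\<in>?P (p + q). of_int (sign \<pi> * sign \<rho> * sign \<tau>) * ?f \<rho> \<pi> * ?g \<tau> \<pi>) =
      exterior (fs @ gs) v" if \<rho>: "\<rho> \<in> ?P p" and \<tau>: "\<tau> \<in> ?P q" for \<rho> \<tau>
  proof -
    obtain \<kappa> where \<kappa>: "\<kappa> permutes {..<p + q}" "sign \<kappa> = sign \<rho> * sign \<tau>"
      "\<And>i. i < p \<Longrightarrow> \<kappa> i = \<rho> i" "\<And>i. i < q \<Longrightarrow> \<kappa> (p + i) = p + \<tau> i"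
      using permutes_append \<rho> \<tau> by blast
    have split: "(\<Prod>i<p + q. F i) = (\<Prod>i<p. F i) * (\<Prod>i<q. F (p + i))" for F :: "nat \<Rightarrow> real"
      by (induction q) (simp_all add: mult.assoc)
    have "exterior (fs @ gs) v =
        (\<Sum>\<pi>\<in>?P (p + q). of_int (sign (\<pi> \<circ> \<kappa>)) *
          (\<Prod>i<p + q. ((fs @ gs) ! i) (v ((\<pi> \<circ> \<kappa>) i))))"
      unfolding exterior_def length_append assms by (rule sum_permutations_compose_right[OF \<kappa>(1)])
    also have "\<dots> = (\<Sum>\<pi>\<in>?P (p + q). of_int (sign \<pi> * sign \<rho> * sign \<tau>) * ?f \<rho> \<pi> * ?g \<tau> \<pi>)"
    proof (intro sum.cong refl)
      fix \<pi> assume "\<pi> \<in> ?P (p + q)"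
      then have "sign (\<pi> \<circ> \<kappa>) = sign \<pi> * sign \<rho> * sign \<tau>"
        using \<kappa>(1,2) by (subst sign_compose) (auto simp: permutation_permutes)
      moreover have "(\<Prod>i<p + q. ((fs @ gs) ! i) (v ((\<pi> \<circ> \<kappa>) i))) = ?f \<rho> \<pi> * ?g \<tau> \<pi>"
        unfolding split using assms \<kappa>(3,4)
        by (intro arg_cong2[where f = "(*)"] prod.cong) (auto simp: nth_append)
      ultimately show "of_int (sign (\<pi> \<circ> \<kappa>)) * (\<Prod>i<p + q. ((fs @ gs) ! i) (v ((\<pi> \<circ> \<kappa>) i))) =
          of_int (sign \<pi> * sign \<rho> * sign \<tau>) * ?f \<rho> \<pi> * ?g \<tau> \<pi>"
        by (simp only: mult.assoc)
    qed
    finally show ?thesis by simp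
  qed
  have "(\<Sum>\<pi>\<in>?P (p + q). of_int (sign \<pi>) * exterior fs (\<lambda>i. v (\<pi> i)) * exterior gs (\<lambda>i. v (\<pi> (p + i)))) =
      (\<Sum>\<pi>\<in>?P (p + q). \<Sum>\<rho>\<in>?P p. \<Sum>\<tau>\<in>?P q. of_int (sign \<pi> * sign \<rho> * sign \<tau>) * ?f \<rho> \<pi> * ?g \<tau> \<pi>)"
    unfolding exterior_def assms
    by (simp add: sum_distrib_left sum_distrib_right mult_ac)
  also have "\<dots> = (\<Sum>\<rho>\<in>?P p. \<Sum>\<tau>\<in>?P q. \<Sum>\<pi>\<in>?P (p + q).
      of_int (sign \<pi> * sign \<rho> * sign \<tau>) * ?f \<rho> \<pi> * ?g \<tau> \<pi>)"
    by (subst sum.swap, rule sum.cong[OF refl], rule sum.swap)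
  also have "\<dots> = (\<Sum>\<rho>\<in>?P p. \<Sum>\<tau>\<in>?P q. exterior (fs @ gs) v)"
    by (intro sum.cong refl inner)
  also have "\<dots> = fact p * fact q * exterior (fs @ gs) v"
    by (simp add: card_permutations)
  finally show ?thesis by (simp add: wedge_def)
qed

lemma wedge_sum:
  assumes "finite I" "finite J"
    "\<And>v. \<alpha> x v = (\<Sum>i\<in>I. a i * A i v)" "\<And>v. \<beta> x v = (\<Sum>j\<in>J. b j * B j v)"
  shows "wedge p q \<alpha> \<beta> x v =
    (\<Sum>i\<in>I. \<Sum>j\<in>J. a i * b j * wedge p q (\<lambda>x. A i) (\<lambda>x. B j) x v)"
proof -
  let ?P = "{\<pi>. \<pi> permutes {..<p + q}}"
  have "(\<Sum>\<pi>\<in>?P. of_int (sign \<pi>) * \<alpha> x (\<lambda>i. v (\<pi> i)) * \<beta> x (\<lambda>i. v (\<pi> (p + i)))) =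
    (\<Sum>\<pi>\<in>?P. \<Sum>i\<in>I. \<Sum>j\<in>J. a i * b j *
       (of_int (sign \<pi>) * A i (\<lambda>i. v (\<pi> i)) * B j (\<lambda>i. v (\<pi> (p + i)))))"
    unfolding assms by (simp add: sum_distrib_left sum_distrib_right mult_ac)
  also have "\<dots> = (\<Sum>i\<in>I. \<Sum>j\<in>J. \<Sum>\<pi>\<in>?P. a i * b j *
       (of_int (sign \<pi>) * A i (\<lambda>i. v (\<pi> i)) * B j (\<lambda>i. v (\<pi> (p + i)))))"
    by (subst sum.swap, rule sum.cong[OF refl], rule sum.swap)
  finally show ?thesis
    by (simp add: wedge_def sum_divide_distrib sum_distrib_left)
qed


section \<open>Real monomials in the imaginary parts\<close>

text \<open>
  Openness matters: the derivatives in \<^const>\<open>C_k_on\<close> are taken in the whole space.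
\<close>

lemma C_k_on_cong:
  assumes "open S" "\<And>x. x \<in> S \<Longrightarrow> f x = g x" "C_k_on k S f"
  shows "C_k_on k S g"
  using assms
proof (induction k arbitrary: f g)
  case 0
  then show ?case by (metis C_k_on.simps(1) continuous_on_cong)
next
  case (Suc k)
  have deriv: "(g has_derivative frechet_derivative f (at x)) (at x)" if "x \<in> S" for x
    using Suc.prems that
    by (metis C_k_on.simps(2) frechet_derivative_works has_derivative_transform_within_open)
  then have eq: "frechet_derivative g (at x) = frechet_derivative f (at x)" if "x \<in> S" for x
    using that frechet_derivative_at by metis
  show ?case
    unfolding C_k_on.simps
  proof safe
    show "g differentiable at x" if "x \<in> S" for x
      using deriv[OF that] by (auto simp: differentiable_def)
    show "C_k_on k S (\<lambda>x. frechet_derivative g (at x) v)" for v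
    proof (rule Suc.IH[OF Suc.prems(1)])
      show "frechet_derivative f (at x) v = frechet_derivative g (at x) v" if "x \<in> S" for x
        using eq[OF that] by simp
      show "C_k_on k S (\<lambda>x. frechet_derivative f (at x) v)"
        using Suc.prems(3) by simp
    qed
  qed
qed

lemma smooth_on_cong:
  assumes "open S" "smooth_on S f" "\<And>x. x \<in> S \<Longrightarrow> f x = g x"
  shows "smooth_on S g"
  unfolding smooth_on_def
proof
  show "C_k_on k S g" for k
    using assms(2) by (intro C_k_on_cong[OF assms(1,3)]) (simp_all add: smooth_on_def)
qed

text \<open>
  The function \<open>\<Prod>\<^sub>i y\<^sub>i\<^bsup>b(i)\<^esup>\<close> of the imaginary parts \<open>y\<^sub>i\<close> of the half-plane coordinates.
\<close>

definition monomial :: "('s \<Rightarrow> real) \<Rightarrow> complex ^ ('s::finite + 't::finite) \<Rightarrow> real" where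
  "monomial b x = exp (\<Sum>i\<in>UNIV. b i * ln (Im (x $ Inl i)))"

lemma monomial_pos: "monomial b x > 0"
  by (simp add: monomial_def)

lemma monomial_add: "monomial (\<lambda>i. b i + c i) x = monomial b x * monomial c x"
  by (simp add: monomial_def distrib_right sum.distrib exp_add)

lemma monomial_zero: "monomial (\<lambda>i. 0) x = 1"
  by (simp add: monomial_def)

lemma monomial_sum_list:
  "monomial (\<lambda>i. \<Sum>l\<leftarrow>ls. b l i) x = (\<Prod>l\<leftarrow>ls. monomial (b l) x)"
  by (induction ls) (simp_all add: monomial_zero monomial_add)

lemma monomial_unit:
  assumes "x \<in> ot_domain"
  shows "monomial (\<lambda>i. if i = j then - 1 else 0) x = 1 / Im (x $ Inl j)"
proof -
  have "monomial (\<lambda>i. if i = j then - 1 else 0) x = exp (- ln (Im (x $ Inl j)))"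
    unfolding monomial_def
    by (rule arg_cong[where f = exp]) (simp add: if_distrib[of "\<lambda>a. a * _"] sum.delta cong: if_cong)
  then show ?thesis using assms by (simp add: ot_domain_def exp_minus divide_inverse)
qed

lemma has_derivative_Im_nth: "((\<lambda>x. Im (x $ l)) has_derivative (\<lambda>v. Im (v $ l))) (at x)"
  by (intro bounded_linear_imp_has_derivative bounded_linear_compose[OF bounded_linear_Im]
      bounded_linear_vec_nth)

lemma has_derivative_monomial:
  assumes "x \<in> ot_domain"
  shows "(monomial b has_derivative
    (\<lambda>v. \<Sum>i\<in>UNIV. monomial b x * b i / Im (x $ Inl i) * Im (v $ Inl i))) (at x)"
proof -
  have pos: "Im (x $ Inl i) > 0" for i using assms by (simp add: ot_domain_def)
  have "((\<lambda>x. ln (Im (x $ Inl i))) has_derivative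
      (\<lambda>v. Im (v $ Inl i) * (1 / Im (x $ Inl i)))) (at x)" for i
    using pos by (intro DERIV_compose_FDERIV[OF DERIV_ln_divide] has_derivative_Im_nth)
  then have "((\<lambda>x. \<Sum>i\<in>UNIV. b i * ln (Im (x $ Inl i))) has_derivative
      (\<lambda>v. \<Sum>i\<in>UNIV. b i * (Im (v $ Inl i) * (1 / Im (x $ Inl i))))) (at x)"
    by (intro has_derivative_sum has_derivative_mult_right)
  from DERIV_compose_FDERIV[OF DERIV_exp this]
  have "(monomial b has_derivative
      (\<lambda>v. (\<Sum>i\<in>UNIV. b i * (Im (v $ Inl i) * (1 / Im (x $ Inl i)))) * monomial b x)) (at x)"
    by (simp add: monomial_def[abs_def])
  then show ?thesis
    by (simp add: sum_distrib_left sum_distrib_right mult_ac)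
qed

text \<open>
  The span of the monomials is closed under directional derivatives, since
  \<open>\<partial>/\<partial>y\<^sub>i\<close> lowers the \<open>i\<close>-th exponent by one.  This gives smoothness of all its members at one stroke.
\<close>

inductive_set laurent :: "(complex ^ ('s::finite + 't::finite) \<Rightarrow> real) set" where
  laurent_monomial: "monomial b \<in> laurent"
| laurent_scale: "f \<in> laurent \<Longrightarrow> (\<lambda>x. r * f x) \<in> laurent"
| laurent_add: "f \<in> laurent \<Longrightarrow> g \<in> laurent \<Longrightarrow> (\<lambda>x. f x + g x) \<in> laurent"

lemma laurent_sum:
  assumes "finite I" "\<And>i. i \<in> I \<Longrightarrow> f i \<in> laurent"
  shows "(\<lambda>x. \<Sum>i\<in>I. f i x) \<in> laurent"
  using assms
proof (induction I)
  case empty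
  show ?case using laurent_scale[OF laurent_monomial, of 0] by simp
next
  case (insert i I)
  then show ?case using laurent_add[of "f i" "\<lambda>x. \<Sum>i\<in>I. f i x"] by simp
qed

lemma laurent_derivative:
  fixes f :: "complex ^ ('s::finite + 't::finite) \<Rightarrow> real"
  assumes "f \<in> laurent"
  shows "\<exists>f'. (\<forall>x\<in>ot_domain. (f has_derivative f' x) (at x)) \<and>
    (\<forall>v. \<exists>g\<in>laurent. \<forall>x\<in>ot_domain. f' x v = g x)"
  using assms
proof induction
  case (laurent_monomial b)
  let ?u = "\<lambda>j i. if i = j then - 1 else (0::real)"
  show ?case
  proof (intro exI conjI ballI allI)
    show "(monomial b has_derivative
        (\<lambda>v. \<Sum>i\<in>UNIV. monomial b x * b i / Im (x $ Inl i) * Im (v $ Inl i))) (at x)"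
      if "x \<in> ot_domain" for x :: "complex ^ ('s + 't)"
      using that by (rule has_derivative_monomial)
    fix v :: "complex ^ ('s + 't)"
    let ?g = "\<lambda>x. \<Sum>j\<in>UNIV. b j * Im (v $ Inl j) * monomial (\<lambda>i. b i + ?u j i) x"
    have "?g \<in> laurent"
      by (intro laurent_sum laurent.laurent_scale laurent.laurent_monomial) simp
    then show "\<exists>g\<in>laurent. \<forall>x\<in>ot_domain.
        (\<Sum>i\<in>UNIV. monomial b x * b i / Im (x $ Inl i) * Im (v $ Inl i)) = g x"
      by (rule bexI[rotated]) (simp add: monomial_add monomial_unit mult_ac)
  qed
next
  case (laurent_scale f r)
  then obtain f' where f': "\<forall>x\<in>ot_domain. (f has_derivative f' x) (at x)"
    "\<forall>v. \<exists>g\<in>laurent. \<forall>x\<in>ot_domain. f' x v = g x" by blast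
  show ?case
    by (rule exI[of _ "\<lambda>x v. r * f' x v"])
       (use f' in \<open>auto intro: has_derivative_mult_right dest: laurent.laurent_scale\<close>,
        metis laurent.laurent_scale)
next
  case (laurent_add f g)
  then obtain f' g' where f': "\<forall>x\<in>ot_domain. (f has_derivative f' x) (at x)"
    "\<forall>v. \<exists>h\<in>laurent. \<forall>x\<in>ot_domain. f' x v = h x"
    and g': "\<forall>x\<in>ot_domain. (g has_derivative g' x) (at x)"
    "\<forall>v. \<exists>h\<in>laurent. \<forall>x\<in>ot_domain. g' x v = h x" by blast
  show ?case
  proof (intro exI conjI ballI allI)
    show "((\<lambda>x. f x + g x) has_derivative (\<lambda>v. f' x v + g' x v)) (at x)" if "x \<in> ot_domain" for x
      using that f'(1) g'(1) by (intro has_derivative_add) auto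
    fix v
    obtain h k where "h \<in> laurent" "\<forall>x\<in>ot_domain. f' x v = h x"
      "k \<in> laurent" "\<forall>x\<in>ot_domain. g' x v = k x" using f'(2) g'(2) by metis
    then show "\<exists>h\<in>laurent. \<forall>x\<in>ot_domain. f' x v + g' x v = h x"
      by (intro bexI[of _ "\<lambda>x. h x + k x"] laurent.laurent_add) auto
  qed
qed

lemma laurent_smooth_on:
  assumes "f \<in> laurent" "open W" "W \<subseteq> ot_domain"
  shows "smooth_on W f"
proof -
  have "C_k_on k W f" for k
    using assms(1)
  proof (induction k arbitrary: f)
    case (0 f)
    then obtain f' where "\<forall>x\<in>ot_domain. (f has_derivative f' x) (at x)"
      using laurent_derivative by blast
    then have "continuous_on W f"
      using assms(3)
      by (intro continuous_at_imp_continuous_on ballI) (blast intro: has_derivative_continuous)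
    then show ?case by simp
  next
    case (Suc k f)
    then obtain f' where f': "\<forall>x\<in>ot_domain. (f has_derivative f' x) (at x)"
      "\<forall>v. \<exists>g\<in>laurent. \<forall>x\<in>ot_domain. f' x v = g x"
      using laurent_derivative by blast
    have "C_k_on k W (\<lambda>x. frechet_derivative f (at x) v)" for v
    proof -
      obtain g where g: "g \<in> laurent" "\<forall>x\<in>ot_domain. f' x v = g x" using f'(2) by blast
      have "g x = frechet_derivative f (at x) v" if "x \<in> W" for x
      proof -
        have "x \<in> ot_domain" using that assms(3) by blast
        then have "f' x = frechet_derivative f (at x)"
          using f'(1) by (intro frechet_derivative_at) blast
        with \<open>x \<in> ot_domain\<close> show ?thesis using g(2) by metis
      qed
      then show ?thesis by (rule C_k_on_cong[OF assms(2) _ Suc.IH[OF g(1)]])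
    qed
    then show ?case using f'(1) assms(3) by (auto simp: differentiable_def)
  qed
  then show ?thesis by (simp add: smooth_on_def)
qed


section \<open>Powers of diagonal forms and their exterior derivatives\<close>

abbreviation dx :: "'n \<Rightarrow> complex ^ 'n::finite \<Rightarrow> real" where "dx l w \<equiv> Re (w $ l)"
abbreviation dy :: "'n \<Rightarrow> complex ^ 'n::finite \<Rightarrow> real" where "dy l w \<equiv> Im (w $ l)"

text \<open>
  The two functionals of an index are adjacent, so that multiplication by one more area form
  \<open>dx\<^sub>l \<and> dy\<^sub>l\<close> prepends two entries to the list.
\<close>

definition area_forms :: "'n list \<Rightarrow> (complex ^ 'n::finite \<Rightarrow> real) list" where
  "area_forms ls = concat (map (\<lambda>l. [dx l, dy l]) ls)"

lemma area_forms_simps [simp]: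
  "area_forms [] = []" "area_forms (l # ls) = dx l # dy l # area_forms ls"
  "length (area_forms ls) = 2 * length ls"
  by (simp_all add: area_forms_def, induction ls) auto

lemma dx_dy_mem_area_forms:
  assumes "l \<in> set ls"
  shows "dx l \<in> set (area_forms ls)" "dy l \<in> set (area_forms ls)"
  using assms by (auto simp: area_forms_def)

lemma distinct_area_formsD: "distinct (area_forms ls) \<Longrightarrow> distinct ls"
  by (induction ls) (auto dest: dx_dy_mem_area_forms)

definition diagonal_form :: "('n \<Rightarrow> complex ^ 'n \<Rightarrow> real) \<Rightarrow> (complex ^ 'n::finite) dform" where
  "diagonal_form h x v = (\<Sum>l\<in>UNIV. h l x * exterior [dx l, dy l] v)"

lemma exterior_pair: "exterior [f, g] v = f (v 0) * g (v 1) - f (v 1) * g (v 0)"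
  by (simp add: exterior_Cons)

text \<open>
  The multinomial expansion of the power, left uncollected.  Lists may repeat an index, and then
  contribute zero, or be permuted; for \<open>m = n - 1\<close> the identity between \<open>d\<Omega>\<^sup>m\<close> and \<open>\<theta> \<and> \<Omega>\<^sup>m\<close> holds
  list by list.
\<close>

lemma wedge_power_diagonal_form:
  "wedge_power (diagonal_form h) m x v =
     (\<Sum>ls | length ls = m. (\<Prod>l\<leftarrow>ls. h l x) * exterior (area_forms ls) v)"
proof (induction m arbitrary: v)
  case 0
  then show ?case by simp
next
  case (Suc m)
  have fin: "finite {ls :: 'a list. length ls = m}"
    using finite_lists_length_eq[of "UNIV :: 'a set" m] by simp
  have lists: "{ls :: 'a list. length ls = Suc m} = case_prod (#) ` (UNIV \<times> {ls. length ls = m})"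
    by (auto simp: length_Suc_conv image_iff)
  have "wedge_power (diagonal_form h) (Suc m) x v =
      (\<Sum>l\<in>UNIV. \<Sum>ls | length ls = m. h l x * (\<Prod>l\<leftarrow>ls. h l x) *
        wedge 2 (2 * m) (\<lambda>x. exterior [dx l, dy l]) (\<lambda>x. exterior (area_forms ls)) x v)"
    unfolding wedge_power.simps
    by (rule wedge_sum) (simp_all add: fin Suc.IH diagonal_form_def)
  also have "\<dots> = (\<Sum>(l, ls)\<in>UNIV \<times> {ls. length ls = m}.
      (\<Prod>l\<leftarrow>l # ls. h l x) * exterior (area_forms (l # ls)) v)"
    by (simp add: wedge_exterior flip: sum.cartesian_product)
  also have "\<dots> = (\<Sum>ls | length ls = Suc m. (\<Prod>l\<leftarrow>ls. h l x) * exterior (area_forms ls) v)"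
    unfolding lists by (subst sum.reindex) (auto simp: inj_on_def case_prod_unfold)
  finally show ?case .
qed

text \<open>
  The differential of \<open>\<Sum>\<^sub>i c\<^sub>i log y\<^sub>i\<close>.
\<close>

definition log_form :: "('s \<Rightarrow> real) \<Rightarrow> (complex ^ ('s::finite + 't::finite)) dform" where
  "log_form c x v = (\<Sum>i\<in>UNIV. c i / Im (x $ Inl i) * dy (Inl i) (v 0))"

text \<open>
  For a list \<open>ls\<close> of \<open>n - 1\<close> indices, the differential of its coefficient contributes
  \<open>dy\<^sub>i / y\<^sub>i\<close> with the exponent of \<open>y\<^sub>i\<close> in \<open>\<Prod>\<^bsub>l\<in>ls\<^esub> h\<^sub>l\<close>.  Its product with the constant form of \<open>ls\<close> is
  nonzero only if \<open>ls\<close> enumerates all indices but \<open>i\<close>, so this exponent may be replaced by the one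
  in \<open>\<Prod>\<^bsub>l\<noteq>i\<^esub> h\<^sub>l\<close>, which is the same for all lists.
\<close>

lemma ext_deriv_wedge_power_diagonal_form:
  fixes b :: "'s::finite + 't::finite \<Rightarrow> 's \<Rightarrow> real"
  defines "m \<equiv> CARD('s + 't) - 1"
    and "\<Omega> \<equiv> diagonal_form (\<lambda>l. monomial (b l))"
    and "\<theta> \<equiv> log_form (\<lambda>i. \<Sum>l\<in>UNIV - {Inl i}. b l i)"
  assumes x: "x \<in> ot_domain"
  shows "ext_deriv (2 * m) (wedge_power \<Omega> m) x v = wedge 1 (2 * m) \<theta> (wedge_power \<Omega> m) x v"
proof -
  let ?N = "{ls :: ('s + 't) list. length ls = m}"
  let ?b = "\<lambda>ls i. \<Sum>l\<leftarrow>ls. b l i"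
  let ?c = "\<lambda>i. \<Sum>l\<in>UNIV - {Inl i}. b l i"
  let ?D = "\<lambda>ls v. \<Sum>i\<in>UNIV. monomial (?b ls) x * ?b ls i / Im (x $ Inl i) * Im (v $ Inl i)"
  have fin: "finite ?N" using finite_lists_length_eq[of "UNIV :: ('s + 't) set" m] by simp
  have power: "wedge_power \<Omega> m y w = (\<Sum>ls\<in>?N. monomial (?b ls) y * exterior (area_forms ls) w)" for y w
    by (simp add: \<Omega>_def wedge_power_diagonal_form monomial_sum_list)
  have deriv: "frechet_derivative (\<lambda>y. wedge_power \<Omega> m y w) (at x) =
      (\<lambda>v. \<Sum>ls\<in>?N. ?D ls v * exterior (area_forms ls) w)" for w
    unfolding power
    by (intro frechet_derivative_at[symmetric] has_derivative_sum has_derivative_mult_left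
        has_derivative_monomial x)
  have key: "?b ls i * exterior (dy (Inl i) # area_forms ls) v =
      ?c i * exterior (dy (Inl i) # area_forms ls) v" if ls: "ls \<in> ?N" for ls i
  proof (cases "distinct ls \<and> Inl i \<notin> set ls")
    case True
    then have "set ls = UNIV - {Inl i}"
      using ls distinct_card[of ls] by (intro card_subset_eq) (auto simp: m_def card_Diff_singleton)
    then show ?thesis using True by (simp add: sum_list_distinct_conv_sum_set)
  next
    case False
    then have "\<not> distinct (dy (Inl i) # area_forms ls)"
      using dx_dy_mem_area_forms(2)[of "Inl i" ls] distinct_area_formsD[of ls] by auto
    then show ?thesis by (simp add: exterior_not_distinct)
  qed
  have "ext_deriv (2 * m) (wedge_power \<Omega> m) x v = (\<Sum>ls\<in>?N. exterior (?D ls # area_forms ls) v)"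
    unfolding ext_deriv_def deriv sum_distrib_left
    by (subst sum.swap) (intro sum.cong refl, simp add: exterior_Cons mult.assoc)
  also have "\<dots> = (\<Sum>ls\<in>?N. \<Sum>i\<in>UNIV. monomial (?b ls) x * ?b ls i / Im (x $ Inl i) *
      exterior (dy (Inl i) # area_forms ls) v)"
    by (intro sum.cong refl exterior_Cons_sum)
  also have "\<dots> = (\<Sum>ls\<in>?N. \<Sum>i\<in>UNIV. monomial (?b ls) x / Im (x $ Inl i) *
      (?c i * exterior (dy (Inl i) # area_forms ls) v))"
    by (intro sum.cong refl) (simp flip: key)
  also have "\<dots> = (\<Sum>i\<in>UNIV. \<Sum>ls\<in>?N. ?c i / Im (x $ Inl i) * monomial (?b ls) x *
      wedge 1 (2 * m) (\<lambda>x. exterior [dy (Inl i)]) (\<lambda>x. exterior (area_forms ls)) x v)"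
    by (subst sum.swap) (intro sum.cong refl, simp add: wedge_exterior)
  also have "\<dots> = wedge 1 (2 * m) \<theta> (wedge_power \<Omega> m) x v"
    by (rule wedge_sum[symmetric]) (simp_all add: fin power \<theta>_def log_form_def exterior_Cons)
  finally show ?thesis .
qed


section \<open>Embeddings of the number field and the group action\<close>

lemma field_embedding_mult: "field_embedding f \<Longrightarrow> f (x * y) = f x * f y"
  and field_embedding_add: "field_embedding f \<Longrightarrow> f (x + y) = f x + f y"
  and field_embedding_one: "field_embedding f \<Longrightarrow> f 1 = 1"
  by (simp_all add: field_embedding_def)

lemma field_embedding_zero: "field_embedding f \<Longrightarrow> f 0 = 0"
  by (drule field_embedding_add[of f 0 0]) (simp only: add_0_right add_cancel_right_right)

lemma field_embedding_eq_0_iff: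
  assumes "field_embedding f"
  shows "f x = 0 \<longleftrightarrow> x = 0"
proof
  assume "f x = 0"
  show "x = 0"
  proof (rule ccontr)
    assume "x \<noteq> 0"
    then have "f (x * inverse x) = 1" by (simp add: field_embedding_one[OF assms])
    then show False using \<open>f x = 0\<close> by (simp add: field_embedding_mult[OF assms])
  qed
qed (simp add: field_embedding_zero[OF assms])

lemma field_embedding_inj:
  assumes "field_embedding f" "f x = f y"
  shows "x = y"
proof -
  have "f (x - y) + f y = f x" by (simp flip: field_embedding_add[OF assms(1)])
  then show ?thesis using assms by (simp add: field_embedding_eq_0_iff)
qed

lemma field_embedding_powi:
  assumes "field_embedding f"
  shows "f (x powi k) = f x powi k"
proof -
  have pow: "f (y ^ n) = f y ^ n" for y n
    by (induction n) (simp_all add: field_embedding_mult[OF assms] field_embedding_one[OF assms])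
  have "f (inverse x) = inverse (f x)"
  proof (cases "x = 0")
    case False
    then have "f x * f (inverse x) = 1"
      by (simp add: field_embedding_one[OF assms] flip: field_embedding_mult[OF assms])
    then show ?thesis by (metis inverse_unique)
  qed (simp add: field_embedding_zero[OF assms])
  then show ?thesis by (simp add: power_int_def pow)
qed

lemma field_embedding_prod:
  "field_embedding f \<Longrightarrow> f (\<Prod>x\<in>A. g x) = (\<Prod>x\<in>A. f (g x))"
  by (induction A rule: infinite_finite_induct)
     (simp_all add: field_embedding_mult field_embedding_one)

text \<open>
  The embedding that acts on the \<open>l\<close>-th coordinate of \<open>\<H>\<^sup>s \<times> \<complex>\<^sup>t\<close>.  Regarding the real ones as complex
  valued treats all coordinates alike.
\<close>

definition place ::
  "('s \<Rightarrow> 'k \<Rightarrow> real) \<Rightarrow> ('t \<Rightarrow> 'k \<Rightarrow> complex) \<Rightarrow> 's + 't \<Rightarrow> 'k \<Rightarrow> complex" where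
  "place \<sigma> \<tau> l a = (case l of Inl i \<Rightarrow> of_real (\<sigma> i a) | Inr j \<Rightarrow> \<tau> j a)"

lemma place_simps [simp]:
  "place \<sigma> \<tau> (Inl i) a = of_real (\<sigma> i a)" "place \<sigma> \<tau> (Inr j) a = \<tau> j a"
  by (simp_all add: place_def)

lemma field_embedding_place:
  assumes "number_field_embeddings \<sigma> \<tau>"
  shows "field_embedding (\<sigma> i)" "field_embedding (\<tau> j)" "field_embedding (place \<sigma> \<tau> l)"
proof -
  show \<sigma>: "field_embedding (\<sigma> i)" for i
    using assms by (auto simp: number_field_embeddings_def bij_betw_def)
  show \<tau>: "field_embedding (\<tau> j)" for j
  proof -
    have "case_sum \<tau> (\<lambda>j a. cnj (\<tau> j a)) (Inl j) \<in> {f. field_embedding f \<and> \<not> range f \<subseteq> \<real>}"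
      using assms unfolding number_field_embeddings_def bij_betw_def by blast
    then show ?thesis by simp
  qed
  show "field_embedding (place \<sigma> \<tau> l)"
    using \<sigma> \<tau> by (cases l) (simp_all add: place_def[abs_def] field_embedding_def)
qed

definition ot_action ::
  "('s::finite \<Rightarrow> 'k \<Rightarrow> real) \<Rightarrow> ('t::finite \<Rightarrow> 'k \<Rightarrow> complex) \<Rightarrow> 'k \<Rightarrow> 'k \<Rightarrow>
   complex ^ ('s + 't) \<Rightarrow> complex ^ ('s + 't)" where
  "ot_action \<sigma> \<tau> u a z = ot_translation \<sigma> \<tau> a (ot_rotation \<sigma> \<tau> u z)"

lemma ot_rotation_nth: "ot_rotation \<sigma> \<tau> u z $ l = place \<sigma> \<tau> l u * z $ l"
  by (simp add: ot_rotation_def place_def)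

lemma ot_action_nth: "ot_action \<sigma> \<tau> u a z $ l = place \<sigma> \<tau> l u * z $ l + place \<sigma> \<tau> l a"
  by (simp add: ot_action_def ot_translation_def ot_rotation_def place_def)

lemma ot_orbit_eq: "ot_orbit \<sigma> \<tau> U z = {ot_action \<sigma> \<tau> u a z | u a. u \<in> U \<and> a \<in> ring_of_integers}"
  by (simp add: ot_orbit_def ot_action_def)

lemma ot_action_ot_action:
  assumes "number_field_embeddings \<sigma> \<tau>"
  shows "ot_action \<sigma> \<tau> v b (ot_action \<sigma> \<tau> u a z) = ot_action \<sigma> \<tau> (v * u) (b + v * a) z"
  by (simp add: Finite_Cartesian_Product.vec_eq_iff ot_action_nth distrib_left mult.assoc
      field_embedding_mult[OF field_embedding_place(3)[OF assms]]
      field_embedding_add[OF field_embedding_place(3)[OF assms]])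

text \<open>
  One half-plane coordinate suffices: its imaginary part determines \<open>\<sigma>\<^sub>i(u)\<close>, then its real part
  determines \<open>\<sigma>\<^sub>i(a)\<close>, and \<open>\<sigma>\<^sub>i\<close> is injective.
\<close>

lemma ot_action_free:
  fixes \<sigma> :: "'s::finite \<Rightarrow> 'k::field_char_0 \<Rightarrow> real" and \<tau> :: "'t::finite \<Rightarrow> 'k \<Rightarrow> complex"
  assumes emb: "number_field_embeddings \<sigma> \<tau>" and z: "z \<in> ot_domain"
    and eq: "ot_action \<sigma> \<tau> u a z = ot_action \<sigma> \<tau> v b z"
  shows "u = v" "a = b"
proof -
  fix i :: 's
  have *: "place \<sigma> \<tau> (Inl i) u * z $ Inl i + place \<sigma> \<tau> (Inl i) a =
      place \<sigma> \<tau> (Inl i) v * z $ Inl i + place \<sigma> \<tau> (Inl i) b"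
    using eq by (simp only: flip: ot_action_nth)
  then have "\<sigma> i u * Im (z $ Inl i) = \<sigma> i v * Im (z $ Inl i)"
    by (simp add: complex_eq_iff)
  moreover have "Im (z $ Inl i) > 0" using z by (simp add: ot_domain_def)
  ultimately have "\<sigma> i u = \<sigma> i v" by simp
  then show "u = v" using field_embedding_inj field_embedding_place(1)[OF emb] by blast
  with * have "\<sigma> i a = \<sigma> i b" by simp
  then show "a = b" using field_embedding_inj field_embedding_place(1)[OF emb] by blast
qed

text \<open>
  If \<open>T\<^sub>a \<circ> R\<^sub>u\<close> preserves the orbit of one point of the domain, it preserves the orbit of every point.
  Freeness transports the information from \<open>z\<close> to \<open>y\<close>: equality of the orbits at \<open>z\<close> says which
  parameters \<open>(v u, b + v a)\<close> belong to \<open>U \<ltimes> \<O>\<^sub>K\<close>.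
\<close>

lemma ot_orbit_action:
  assumes emb: "number_field_embeddings \<sigma> \<tau>" and U: "mult_subgroup U" "u \<in> U"
    and z: "z \<in> ot_domain" and eq: "ot_orbit \<sigma> \<tau> U (ot_action \<sigma> \<tau> u a z) = ot_orbit \<sigma> \<tau> U z"
  shows "ot_orbit \<sigma> \<tau> U (ot_action \<sigma> \<tau> u a y) = ot_orbit \<sigma> \<tau> U y"
proof (intro equalityI subsetI)
  fix w assume "w \<in> ot_orbit \<sigma> \<tau> U (ot_action \<sigma> \<tau> u a y)"
  then obtain v b where v: "v \<in> U" "b \<in> ring_of_integers"
    and w: "w = ot_action \<sigma> \<tau> (v * u) (b + v * a) y"
    by (auto simp: ot_orbit_eq ot_action_ot_action[OF emb])
  have "ot_action \<sigma> \<tau> (v * u) (b + v * a) z \<in> ot_orbit \<sigma> \<tau> U z"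
    unfolding eq[symmetric] using v by (auto simp: ot_orbit_eq ot_action_ot_action[OF emb])
  then obtain v' b' where "v' \<in> U" "b' \<in> ring_of_integers"
    "ot_action \<sigma> \<tau> (v * u) (b + v * a) z = ot_action \<sigma> \<tau> v' b' z"
    by (auto simp: ot_orbit_eq)
  with ot_action_free[OF emb z this(3)] show "w \<in> ot_orbit \<sigma> \<tau> U y"
    by (auto simp: ot_orbit_eq w)
next
  fix w assume "w \<in> ot_orbit \<sigma> \<tau> U y"
  then obtain v b where v: "v \<in> U" "b \<in> ring_of_integers" and w: "w = ot_action \<sigma> \<tau> v b y"
    by (auto simp: ot_orbit_eq)
  have "ot_action \<sigma> \<tau> v b z \<in> ot_orbit \<sigma> \<tau> U (ot_action \<sigma> \<tau> u a z)"
    unfolding eq using v by (auto simp: ot_orbit_eq)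
  then obtain v' b' where *: "v' \<in> U" "b' \<in> ring_of_integers"
    "ot_action \<sigma> \<tau> v b z = ot_action \<sigma> \<tau> (v' * u) (b' + v' * a) z"
    by (auto simp: ot_orbit_eq ot_action_ot_action[OF emb])
  have "w = ot_action \<sigma> \<tau> v' b' (ot_action \<sigma> \<tau> u a y)"
    using ot_action_free[OF emb z *(3)] by (simp add: w ot_action_ot_action[OF emb])
  with * show "w \<in> ot_orbit \<sigma> \<tau> U (ot_action \<sigma> \<tau> u a y)"
    by (auto simp: ot_orbit_eq)
qed


section \<open>Transition maps of the quotient\<close>

lemma ot_orbit_self:
  assumes "number_field_embeddings \<sigma> \<tau>" "mult_subgroup U"
  shows "z \<in> ot_orbit \<sigma> \<tau> U z"
proof -
  have "ot_action \<sigma> \<tau> 1 0 z = z"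
    by (simp add: Finite_Cartesian_Product.vec_eq_iff ot_action_nth field_embedding_one field_embedding_zero
        field_embedding_place(3)[OF assms(1)])
  then show ?thesis
    using assms(2) by (force simp: ot_orbit_eq mult_subgroup_def ring_of_integers_def)
qed

lemma linear_ot_rotation: "linear (ot_rotation \<sigma> \<tau> u)"
  by (rule linearI) (simp_all add: Finite_Cartesian_Product.vec_eq_iff ot_rotation_nth distrib_left)

lemma ot_action_has_derivative:
  "(ot_action \<sigma> \<tau> u a has_derivative ot_rotation \<sigma> \<tau> u) (at z)"
proof -
  have "ot_action \<sigma> \<tau> u a = (\<lambda>z. ot_rotation \<sigma> \<tau> u z + (\<chi> l. place \<sigma> \<tau> l a))"
    by (simp add: fun_eq_iff Finite_Cartesian_Product.vec_eq_iff ot_action_nth ot_rotation_nth)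
  then show ?thesis
    using linear_imp_has_derivative[OF linear_ot_rotation]
    by (auto intro!: has_derivative_add_const)
qed

text \<open>
  The transition map sends \<open>x\<close> to a point \<open>x'\<close> of the same orbit, so \<open>x' = T\<^sub>a (R\<^sub>u x)\<close>.  For \<open>y\<close> near \<open>x\<close>,
  the point \<open>T\<^sub>a (R\<^sub>u y)\<close> lies in the open set \<open>W'\<close> on which the projection is injective, and it lies over
  the same point of the quotient as \<open>y\<close>; hence it is the image of \<open>y\<close>.  Thus the transition map
  agrees with \<open>T\<^sub>a \<circ> R\<^sub>u\<close> near \<open>x\<close> and has derivative \<open>R\<^sub>u\<close>.
\<close>

lemma ot_transition:
  assumes emb: "number_field_embeddings \<sigma> \<tau>" and U: "mult_subgroup U"
    and c: "c \<in> ot_manifold \<sigma> \<tau> U" "c' \<in> ot_manifold \<sigma> \<tau> U"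
    and x: "x \<in> snd c ` (fst c \<inter> fst c')"
  obtains u a where "u \<in> U" "x \<in> ot_domain" "transition c c' x = ot_action \<sigma> \<tau> u a x"
    "frechet_derivative (transition c c') (at x) = ot_rotation \<sigma> \<tau> u"
proof -
  let ?p = "ot_orbit \<sigma> \<tau> U"
  obtain W W' where W: "c = (?p ` W, inv_into W ?p)" "open W" "W \<subseteq> ot_domain" "inj_on ?p W"
    and W': "c' = (?p ` W', inv_into W' ?p)" "open W'" "W' \<subseteq> ot_domain" "inj_on ?p W'"
    using c by (auto simp: ot_manifold_def quotient_atlas_def)
  have trans: "transition c c' y = inv_into W' ?p (?p y)" if "y \<in> W" for y
  proof -
    have "inv_into (?p ` W) (inv_into W ?p) y = ?p y"
      using that W(4) by (metis bij_betw_def bij_betw_inv_into inv_into_f_f inv_into_inv_into_eq)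
    then show ?thesis by (simp add: transition_def W W')
  qed
  obtain P where P: "P \<in> ?p ` W" "P \<in> ?p ` W'" "x = inv_into W ?p P"
    using x unfolding W(1) W'(1) fst_conv snd_conv by blast
  then have xW: "x \<in> W" "?p x \<in> ?p ` W'"
    by (simp_all only: inv_into_into f_inv_into_f)
  define x' where "x' = transition c c' x"
  have x': "x' \<in> W'" "?p x' = ?p x"
    using xW by (auto simp: x'_def trans inv_into_into f_inv_into_f)
  then have "x' \<in> ?p x" using ot_orbit_self[OF emb U] by metis
  then obtain u a where u: "u \<in> U" and ua: "x' = ot_action \<sigma> \<tau> u a x"
    by (auto simp: ot_orbit_eq)
  have xdom: "x \<in> ot_domain" using xW W by blast
  have cont: "continuous_on UNIV (ot_action \<sigma> \<tau> u a)"
    by (intro continuous_at_imp_continuous_on ballI has_derivative_continuous[OF ot_action_has_derivative])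
  \<comment> \<open>the points near \<open>x\<close> at which the group element takes values in the second chart\<close>
  define N where "N = W \<inter> ot_action \<sigma> \<tau> u a -` W'"
  have N: "open N" "x \<in> N"
    using W(2) W'(2) xW x' ua continuous_on_open_vimage[OF open_UNIV, THEN iffD1, OF cont]
    by (auto simp: N_def)
  have local_eq: "ot_action \<sigma> \<tau> u a y = transition c c' y" if "y \<in> N" for y
  proof -
    have "?p (ot_action \<sigma> \<tau> u a y) = ?p y"
      using ot_orbit_action[OF emb U u xdom] x'(2) ua by metis
    with that show ?thesis
      using W'(4) by (metis N_def IntD1 IntD2 inv_into_f_f trans vimageD)
  qed
  have "(transition c c' has_derivative ot_rotation \<sigma> \<tau> u) (at x)"
    by (rule has_derivative_transform_within_open[OF ot_action_has_derivative N local_eq])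
  then have "frechet_derivative (transition c c') (at x) = ot_rotation \<sigma> \<tau> u"
    by (rule frechet_derivative_at[symmetric])
  then show ?thesis using ua unfolding x'_def by (intro that[OF u xdom])
qed

lemma chart_image_ot_manifold:
  assumes "c \<in> ot_manifold \<sigma> \<tau> U"
  shows "open (chart_image c)" "chart_image c \<subseteq> ot_domain"
proof -
  let ?p = "ot_orbit \<sigma> \<tau> U"
  obtain W where W: "c = (?p ` W, inv_into W ?p)" "open W" "W \<subseteq> ot_domain" "inj_on ?p W"
    using assms by (auto simp: ot_manifold_def quotient_atlas_def)
  then have "chart_image c = W"
    by (simp add: chart_image_def inv_into_image_cancel)
  with W show "open (chart_image c)" "chart_image c \<subseteq> ot_domain" by simp_all
qed


section \<open>The metric and the Lee form on the quotient\<close>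

lemma monomial_ot_action:
  assumes "x \<in> ot_domain" "\<And>i. \<sigma> i u > 0"
  shows "monomial b (ot_action \<sigma> \<tau> u a x) = exp (\<Sum>i\<in>UNIV. b i * ln (\<sigma> i u)) * monomial b x"
proof -
  have "ln (Im (ot_action \<sigma> \<tau> u a x $ Inl i)) = ln (\<sigma> i u) + ln (Im (x $ Inl i))" for i
  proof -
    have "\<sigma> i u \<noteq> 0" "Im (x $ Inl i) \<noteq> 0"
      using assms(1) assms(2)[of i] by (auto simp: ot_domain_def dest: spec[of _ i])
    then show ?thesis by (simp add: ot_action_nth ln_mult)
  qed
  then show ?thesis
    by (simp add: monomial_def distrib_left sum.distrib exp_add)
qed

text \<open>
  Multiplication by a complex number \<open>c\<close> has real determinant \<open>\<bar>c\<bar>\<^sup>2\<close>.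
\<close>

lemma area_form_ot_rotation:
  "exterior [dx l, dy l] (\<lambda>i. ot_rotation \<sigma> \<tau> u (v i)) =
     (cmod (place \<sigma> \<tau> l u))\<^sup>2 * exterior [dx l, dy l] v"
proof -
  have "(a * p - b * q) * (a * s + b * r) - (a * r - b * s) * (a * q + b * p) =
      (a\<^sup>2 + b\<^sup>2) * (p * s - r * q)" for a b p q r s :: real
    by (simp add: power2_eq_square algebra_simps)
  then show ?thesis
    unfolding exterior_pair ot_rotation_nth cmod_power2 times_complex.sel .
qed

text \<open>
  The hypothesis on \<open>b\<close> says that the coefficient of \<open>dx\<^sub>l \<and> dy\<^sub>l\<close> is divided by \<open>\<bar>c\<bar>\<^sup>2\<close> under \<open>R\<^sub>u\<close>, where
  \<open>c\<close> is the image of \<open>u\<close> at the place \<open>l\<close>; this cancels the determinant by which \<open>dx\<^sub>l \<and> dy\<^sub>l\<close> is scaled.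
\<close>

lemma mform_diagonal_form:
  assumes emb: "number_field_embeddings \<sigma> \<tau>" and U: "mult_subgroup U" "U \<subseteq> totally_positive_units \<sigma>"
    and b: "\<And>u l. u \<in> U \<Longrightarrow> (\<Sum>i\<in>UNIV. b l i * ln (\<sigma> i u)) = - 2 * ln (cmod (place \<sigma> \<tau> l u))"
  shows "mform (ot_manifold \<sigma> \<tau> U) 2 (\<lambda>c. diagonal_form (\<lambda>l. monomial (b l)))"
  unfolding mform_def smooth_form_on_def
proof (intro conjI ballI allI)
  fix c x assume "c \<in> ot_manifold \<sigma> \<tau> U" "x \<in> chart_image c"
  show "alternating 2 (diagonal_form (\<lambda>l. monomial (b l)) x)"
    unfolding alternating_def diagonal_form_def exterior_pair
    by (auto simp: less_2_cases_iff algebra_simps sum.distrib sum_distrib_left sum_subtractf intro!: linearI)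
next
  fix c v assume c: "c \<in> ot_manifold \<sigma> \<tau> U"
  have "(\<lambda>x. \<Sum>l\<in>UNIV. exterior [dx l, dy l] v * monomial (b l) x) \<in> laurent"
    by (intro laurent_sum laurent_scale laurent_monomial) simp
  then show "smooth_on (chart_image c) (\<lambda>x. diagonal_form (\<lambda>l. monomial (b l)) x v)"
    unfolding diagonal_form_def mult.commute[of "monomial _ _"]
    using chart_image_ot_manifold[OF c] by (rule laurent_smooth_on)
next
  fix c c' x v
  assume c: "c \<in> ot_manifold \<sigma> \<tau> U" "c' \<in> ot_manifold \<sigma> \<tau> U" and x: "x \<in> snd c ` (fst c \<inter> fst c')"
  obtain u a where u: "u \<in> U" "x \<in> ot_domain" "transition c c' x = ot_action \<sigma> \<tau> u a x"
    "frechet_derivative (transition c c') (at x) = ot_rotation \<sigma> \<tau> u"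
    using ot_transition[OF emb U(1) c x] .
  have pos: "\<sigma> i u > 0" for i using U(2) u(1) by (auto simp: totally_positive_units_def)
  have "place \<sigma> \<tau> l u \<noteq> 0" for l
    using U(1) u(1) by (auto simp: field_embedding_eq_0_iff[OF field_embedding_place(3)[OF emb]] mult_subgroup_def)
  \<comment> \<open>the scaling factors of the coefficient and of the area form cancel\<close>
  then have inv: "exp (- (2 * ln (cmod (place \<sigma> \<tau> l u)))) * (cmod (place \<sigma> \<tau> l u))\<^sup>2 = 1" for l
    by (simp add: exp_minus exp_double)
  have "exp (- (2 * ln (cmod (place \<sigma> \<tau> l u)))) * r * ((cmod (place \<sigma> \<tau> l u))\<^sup>2 * e) = r * e" for l r e
    using arg_cong[OF inv[of l], of "\<lambda>y. y * (r * e)"] by (simp only: mult_ac mult_1)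
  from this[symmetric] show "diagonal_form (\<lambda>l. monomial (b l)) x v =
      pullback (transition c c') (diagonal_form (\<lambda>l. monomial (b l))) x v"
    unfolding pullback_def u diagonal_form_def area_form_ot_rotation
      monomial_ot_action[where \<sigma> = \<sigma> and u = u, OF u(2) pos] b[OF u(1)]
    by (intro sum.cong refl) simp
qed

lemma hermitian_metric_diagonal_form:
  fixes h :: "'n::finite \<Rightarrow> complex ^ 'n \<Rightarrow> real"
  assumes "mform A 2 (\<lambda>c. diagonal_form h)" "\<And>l x. h l x > 0"
  shows "hermitian_metric A (\<lambda>c. diagonal_form h)"
  unfolding hermitian_metric_def
proof (intro conjI ballI allI impI)
  fix v x
  show "diagonal_form h x (\<lambda>i. \<i> *s v i) = diagonal_form h x v"
    by (simp add: diagonal_form_def exterior_pair algebra_simps)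
next
  fix v :: "complex ^ 'n" and x
  assume "v \<noteq> 0"
  then obtain l where l: "v $ l \<noteq> 0" by (auto simp: Finite_Cartesian_Product.vec_eq_iff)
  have "diagonal_form h x (\<lambda>i. if i = 0 then v else \<i> *s v) = (\<Sum>l\<in>UNIV. h l x * (cmod (v $ l))\<^sup>2)"
    unfolding diagonal_form_def exterior_pair cmod_power2 by (simp add: power2_eq_square)
  also have "\<dots> > 0"
    by (rule sum_pos2[of _ l]) (use assms(2) l in \<open>auto simp: less_imp_le\<close>)
  finally show "diagonal_form h x (\<lambda>i. if i = 0 then v else \<i> *s v) > 0" .
qed (rule assms(1))

text \<open>
  Invariance holds because \<open>y\<^sub>i\<close> and \<open>dy\<^sub>i\<close> are scaled by the same factor \<open>\<sigma>\<^sub>i(u)\<close>.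
\<close>

lemma closed_mform_log_form:
  fixes \<sigma> :: "'s::finite \<Rightarrow> 'k::field_char_0 \<Rightarrow> real" and \<tau> :: "'t::finite \<Rightarrow> 'k \<Rightarrow> complex"
  assumes emb: "number_field_embeddings \<sigma> \<tau>" and U: "mult_subgroup U" "U \<subseteq> totally_positive_units \<sigma>"
  shows "closed_mform (ot_manifold \<sigma> \<tau> U) 1 (\<lambda>c. log_form r)"
  unfolding closed_mform_def mform_def smooth_form_on_def mform_eq_def
proof (intro conjI ballI allI)
  fix c x assume "c \<in> ot_manifold \<sigma> \<tau> U" "x \<in> chart_image c"
  show "alternating 1 (log_form r x)"
    unfolding alternating_def log_form_def
    by (auto simp: algebra_simps sum.distrib sum_distrib_left add_divide_distrib intro!: linearI)
next
  fix c and v :: "nat \<Rightarrow> complex ^ ('s + 't)"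
  assume c: "c \<in> ot_manifold \<sigma> \<tau> U"
  let ?u = "\<lambda>j i. if i = j then - 1 else 0"
  have "(\<lambda>x. \<Sum>j\<in>UNIV. r j * dy (Inl j) (v 0) * monomial (?u j) x) \<in> laurent"
    by (intro laurent_sum laurent_scale laurent_monomial) simp
  then have "smooth_on (chart_image c) (\<lambda>x. \<Sum>j\<in>UNIV. r j * dy (Inl j) (v 0) * monomial (?u j) x)"
    using chart_image_ot_manifold[OF c] by (rule laurent_smooth_on)
  then show "smooth_on (chart_image c) (\<lambda>x. log_form r x v)"
  proof (rule smooth_on_cong[OF chart_image_ot_manifold(1)[OF c]])
    fix x assume "x \<in> chart_image c"
    then have "x \<in> ot_domain" using chart_image_ot_manifold(2)[OF c] by blast
    then show "(\<Sum>j\<in>UNIV. r j * dy (Inl j) (v 0) * monomial (?u j) x) = log_form r x v"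
      by (simp add: log_form_def monomial_unit)
  qed
next
  fix c c' x v
  assume c: "c \<in> ot_manifold \<sigma> \<tau> U" "c' \<in> ot_manifold \<sigma> \<tau> U" and x: "x \<in> snd c ` (fst c \<inter> fst c')"
  obtain u a where u: "u \<in> U" "x \<in> ot_domain" "transition c c' x = ot_action \<sigma> \<tau> u a x"
    "frechet_derivative (transition c c') (at x) = ot_rotation \<sigma> \<tau> u"
    using ot_transition[OF emb U(1) c x] .
  have pos: "\<sigma> i u > 0" for i using U(2) u(1) by (auto simp: totally_positive_units_def)
  then have "\<sigma> i u \<noteq> 0" for i by (metis less_irrefl)
  then show "log_form r x v = pullback (transition c c') (log_form r) x v"
    by (simp add: pullback_def u log_form_def ot_action_nth ot_rotation_nth)
next
  fix c x v assume c: "c \<in> ot_manifold \<sigma> \<tau> U" and "x \<in> chart_image c"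
  then have x: "x \<in> ot_domain" using chart_image_ot_manifold by blast
  then have nz: "Im (x $ Inl i) \<noteq> 0" for i by (auto simp: ot_domain_def dest: spec[of _ i])
  have "((\<lambda>t. r i / t) has_field_derivative - r i / t\<^sup>2) (at t)" if "t \<noteq> 0" for i t
    by (auto intro!: derivative_eq_intros simp: that power2_eq_square)
  from DERIV_compose_FDERIV[OF this[OF nz] has_derivative_Im_nth]
  have "((\<lambda>y. log_form r y w) has_derivative
      (\<lambda>v. \<Sum>i\<in>UNIV. Im (v $ Inl i) * (- r i / (Im (x $ Inl i))\<^sup>2) * Im (w 0 $ Inl i))) (at x)" for w
    unfolding log_form_def by (intro has_derivative_sum has_derivative_mult_left)
  from frechet_derivative_at[OF this, symmetric]
  show "ext_deriv 1 (log_form r) x v = 0"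
    by (simp add: ext_deriv_def mult_ac)
qed


section \<open>The logarithmic relation of an admissible group\<close>

lemma ln_powi:
  fixes x :: real
  assumes "x > 0"
  shows "ln (x powi k) = of_int k * ln x"
  using assms by (simp add: ln_powr flip: powr_real_of_int')

lemma ln_cmod_embedding_prod_powi:
  fixes f :: "'k::field \<Rightarrow> complex"
  assumes f: "field_embedding f" and B: "0 \<notin> B" "finite B"
  shows "ln (cmod (f (\<Prod>b\<in>B. b powi k b))) = (\<Sum>b\<in>B. of_int (k b) * ln (cmod (f b)))"
proof -
  have pos: "cmod (f b) > 0" if "b \<in> B" for b
    using that B by (auto simp: field_embedding_eq_0_iff[OF f])
  have "cmod (f (\<Prod>b\<in>B. b powi k b)) = (\<Prod>b\<in>B. cmod (f b) powi k b)"
    by (simp add: field_embedding_prod[OF f] field_embedding_powi[OF f] norm_power_int flip: prod_norm)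
  then show ?thesis using pos B by (simp add: ln_prod ln_powi)
qed

text \<open>
  The \<open>s\<close> generators of \<open>U\<close> are mapped by the logarithms of the real places to vectors that span a
  space containing the lattice, hence all of \<open>\<real>\<^sup>s\<close>.  Being \<open>s\<close> in number, these vectors are
  distinct and form a basis, so there is a linear functional with prescribed values
  \<open>2 log \<bar>\<tau>\<^sub>j(b)\<bar>\<close> on them.  Additivity extends the relation from the generators to \<open>U\<close>.
\<close>

lemma admissible_log_relation:
  fixes \<sigma> :: "'s::finite \<Rightarrow> 'k::field_char_0 \<Rightarrow> real" and \<tau> :: "'t::finite \<Rightarrow> 'k \<Rightarrow> complex"
  assumes emb: "number_field_embeddings \<sigma> \<tau>" and adm: "admissible \<sigma> \<tau> U"
  obtains a :: "'t \<Rightarrow> 's \<Rightarrow> real" where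
    "\<And>j u. u \<in> U \<Longrightarrow> 2 * ln (cmod (\<tau> j u)) = (\<Sum>i\<in>UNIV. a j i * ln (\<sigma> i u))"
proof -
  have pos: "\<sigma> i u > 0" if "u \<in> U" for i u
    using adm that by (auto simp: admissible_def totally_positive_units_def)
  obtain B where B: "finite B" "card B = CARD('s)"
    "bij_betw (\<lambda>k. \<Prod>b\<in>B. b powi k b) (B \<rightarrow>\<^sub>E (UNIV :: int set)) U"
    using adm by (auto simp: admissible_def free_of_rank_def)
  have "B \<subseteq> U"
  proof
    fix b assume b: "b \<in> B"
    \<comment> \<open>the exponent vector with a single entry one\<close>
    let ?k = "\<lambda>c\<in>B. if c = b then 1 else 0 :: int"
    have "(\<Prod>c\<in>B. c powi ?k c) = (\<Prod>c\<in>B. if c = b then c else 1)"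
      by (intro prod.cong) auto
    also have "\<dots> = b" using b B(1) by simp
    finally have "(\<Prod>c\<in>B. c powi ?k c) = b" .
    moreover have "(\<Prod>c\<in>B. c powi ?k c) \<in> U"
      by (rule bij_betwE[OF B(3), rule_format]) (auto simp: PiE_iff extensional_def)
    ultimately show "b \<in> U" by simp
  qed
  then have "0 \<notin> B" using adm by (auto simp: admissible_def mult_subgroup_def)
  define w :: "'k \<Rightarrow> real ^ 's" where "w u = real_part_projection (log_embedding \<sigma> \<tau> u)" for u
  have w_nth: "w u $ i = ln (\<sigma> i u)" for u i
    by (simp add: w_def real_part_projection_def log_embedding_def)
  have w_prod: "w (\<Prod>b\<in>B. b powi k b) = (\<Sum>b\<in>B. of_int (k b) *\<^sub>R w b)"
    if "(\<Prod>b\<in>B. b powi k b) \<in> U" for k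
  proof -
    have "ln (\<sigma> i (\<Prod>b\<in>B. b powi k b)) = (\<Sum>b\<in>B. of_int (k b) * ln (\<sigma> i b))" for i
    proof -
      have ln: "ln (\<sigma> i u) = ln (cmod (place \<sigma> \<tau> (Inl i) u))" if "u \<in> U" for u
        using pos[OF that, of i] by simp
      have "(\<Sum>b\<in>B. of_int (k b) * ln (\<sigma> i b)) =
          (\<Sum>b\<in>B. of_int (k b) * ln (cmod (place \<sigma> \<tau> (Inl i) b)))"
        using \<open>B \<subseteq> U\<close> by (intro sum.cong refl arg_cong2[where f = "(*)"] ln) blast
      then show ?thesis
        using ln_cmod_embedding_prod_powi[OF field_embedding_place(3)[OF emb] \<open>0 \<notin> B\<close> B(1)]
        by (simp only: ln[OF that])
    qed
    then show ?thesis by (simp add: Finite_Cartesian_Product.vec_eq_iff w_nth)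
  qed
  have "lattice_of_rank CARD('s) (w ` U)"
    using adm by (simp add: admissible_def image_image w_def)
  then obtain C where C: "finite C" "card C = CARD('s)" "independent C"
    "w ` U = range (\<lambda>k :: real ^ 's \<Rightarrow> int. \<Sum>c\<in>C. of_int (k c) *\<^sub>R c)"
    unfolding lattice_of_rank_def by (elim exE conjE)
  have "C \<subseteq> w ` U"
  proof
    fix c assume c: "c \<in> C"
    have "(\<Sum>d\<in>C. of_int (if d = c then 1 else 0) *\<^sub>R d) = (\<Sum>d\<in>C. if d = c then d else 0)"
      by (intro sum.cong) auto
    also have "\<dots> = c" using c C(1) by simp
    finally show "c \<in> w ` U" unfolding C(4) by (intro range_eqI) (rule sym)
  qed
  also have "w ` U \<subseteq> span (w ` B)"
  proof safe
    fix u assume u: "u \<in> U"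
    then obtain k where k: "u = (\<Prod>b\<in>B. b powi k b)"
      using B(3) by (auto simp: bij_betw_def)
    show "w u \<in> span (w ` B)"
      using u unfolding k by (subst w_prod) (simp_all add: span_sum span_scale span_base)
  qed
  finally have "card C \<le> dim (w ` B)"
    using independent_card_le_dim[of C "span (w ` B)"] C(3) by simp
  with B C have le: "card B \<le> dim (w ` B)" by simp
  have "card (w ` B) = card B"
    using le dim_le_card'[of "w ` B"] card_image_le[OF B(1), of w] B(1) by simp
  then have inj: "inj_on w B" by (simp add: B(1) inj_on_iff_eq_card)
  have ind: "independent (w ` B)"
    using le \<open>card (w ` B) = card B\<close> B(1)
    by (intro card_le_dim_spanning[of _ "w ` B"]) (auto intro: span_base)
  have "\<exists>a. \<forall>u\<in>U. 2 * ln (cmod (\<tau> j u)) = (\<Sum>i\<in>UNIV. a i * ln (\<sigma> i u))" for j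
  proof -
    obtain g where g: "linear g" "\<forall>y\<in>w ` B. g y = 2 * ln (cmod (\<tau> j (inv_into B w y)))"
      using linear_independent_extend[OF ind, of "\<lambda>y. 2 * ln (cmod (\<tau> j (inv_into B w y)))"] by blast
    have g_w: "g (w b) = 2 * ln (cmod (\<tau> j b))" if "b \<in> B" for b
      using g(2) that inj by simp
    have "2 * ln (cmod (\<tau> j u)) = (\<Sum>i\<in>UNIV. g (axis i 1) * ln (\<sigma> i u))" if u: "u \<in> U" for u
    proof -
      obtain k where k: "u = (\<Prod>b\<in>B. b powi k b)"
        using B(3) u by (auto simp: bij_betw_def)
      have "2 * ln (cmod (\<tau> j u)) = (\<Sum>b\<in>B. of_int (k b) * g (w b))"
        unfolding k ln_cmod_embedding_prod_powi[OF field_embedding_place(2)[OF emb] \<open>0 \<notin> B\<close> B(1)]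
        by (simp add: sum_distrib_left g_w mult_ac)
      also have "\<dots> = g (w u)"
        using u unfolding k by (simp add: w_prod linear_sum[OF g(1)] linear_cmul[OF g(1)])
      also have "\<dots> = g (\<Sum>i\<in>UNIV. (w u $ i) *\<^sub>R axis i 1)"
        by (simp add: basis_expansion flip: scalar_mult_eq_scaleR)
      also have "\<dots> = (\<Sum>i\<in>UNIV. g (axis i 1) * ln (\<sigma> i u))"
        by (simp add: linear_sum[OF g(1)] linear_cmul[OF g(1)] w_nth mult.commute)
      finally show ?thesis .
    qed
    then show ?thesis by (intro exI[of _ "\<lambda>i. g (axis i 1)"]) blast
  qed
  then show ?thesis using that by metis
qed

theorem theorem1p3:
  fixes \<sigma> :: "'s::finite \<Rightarrow> 'k::field_char_0 \<Rightarrow> real"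
    and \<tau> :: "'t::finite \<Rightarrow> 'k \<Rightarrow> complex"
    and U :: "'k set"
  assumes "number_field_embeddings \<sigma> \<tau>"
    and "admissible \<sigma> \<tau> U"
  shows "\<exists>\<Omega>. locally_conformally_balanced (ot_manifold \<sigma> \<tau> U) \<Omega>"
proof -
  have U: "mult_subgroup U" "U \<subseteq> totally_positive_units \<sigma>"
    using assms(2) by (simp_all add: admissible_def)
  obtain a :: "'t \<Rightarrow> 's \<Rightarrow> real" where
    a: "\<And>j u. u \<in> U \<Longrightarrow> 2 * ln (cmod (\<tau> j u)) = (\<Sum>i\<in>UNIV. a j i * ln (\<sigma> i u))"
    using admissible_log_relation[OF assms] by blast
  \<comment> \<open>the exponents of the monomials \<open>y\<^sub>i\<^bsup>-2\<^esup>\<close> and \<open>\<Prod>\<^sub>i y\<^sub>i\<^bsup>-a(j,i)\<^esup>\<close>\<close>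
  define b where "b l i = (case l of Inl i' \<Rightarrow> if i = i' then - 2 else 0 | Inr j \<Rightarrow> - a j i)"
    for l :: "'s + 't" and i
  have b: "(\<Sum>i\<in>UNIV. b l i * ln (\<sigma> i u)) = - 2 * ln (cmod (place \<sigma> \<tau> l u))" if "u \<in> U" for l u
  proof (cases l)
    case (Inl i')
    have "\<sigma> i' u > 0" using that U(2) by (auto simp: totally_positive_units_def)
    moreover have "(\<Sum>i\<in>UNIV. b l i * ln (\<sigma> i u)) = (\<Sum>i\<in>UNIV. if i = i' then - 2 * ln (\<sigma> i u) else 0)"
      by (intro sum.cong) (auto simp: b_def Inl)
    ultimately show ?thesis by (simp add: Inl)
  next
    case (Inr j)
    then show ?thesis using a[OF that, of j] by (simp add: b_def sum_negf)
  qed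
  let ?A = "ot_manifold \<sigma> \<tau> U"
  let ?\<Omega> = "diagonal_form (\<lambda>l. monomial (b l))"
  let ?\<theta> = "log_form (\<lambda>i. \<Sum>l\<in>UNIV - {Inl i}. b l i)"
  have "hermitian_metric ?A (\<lambda>c. ?\<Omega>)"
    using mform_diagonal_form[OF assms(1) U b] monomial_pos by (rule hermitian_metric_diagonal_form)
  moreover have "closed_mform ?A 1 (\<lambda>c. ?\<theta>)"
    using assms(1) U by (rule closed_mform_log_form)
  moreover have "mform_eq ?A
      (\<lambda>c. ext_deriv (2 * (CARD('s + 't) - 1)) (wedge_power ?\<Omega> (CARD('s + 't) - 1)))
      (\<lambda>c. wedge 1 (2 * (CARD('s + 't) - 1)) ?\<theta> (wedge_power ?\<Omega> (CARD('s + 't) - 1)))"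
    unfolding mform_eq_def
    using chart_image_ot_manifold(2) ext_deriv_wedge_power_diagonal_form by blast
  ultimately show ?thesis
    unfolding locally_conformally_balanced_def Let_def by blast
qed

end
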